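(* Let $p\ge 2$ be an integer. The generating function of the order of $\Gamma_n^{(p)}$ is $$\sum_{n\geq 0}|V(\Gamma^{(p)}_{n})|\,t^n=t^{-1}\left(\frac{1}{1-t-t^2-\dots-t^{p}}-1\right)=\frac{1+t+\dots+t^{p-1}}{1-t-t^2-\dots-t^{p}},$$ as an identity of formal power series in $t$.
   Context: For an integer $n\ge 0$, the hypercube $Q_n$ has vertex set $\{0,1\}^n$ (binary strings of length $n$; for $n=0$ only the empty string), two strings being adjacent iff they differ in exactly one coordinate. For $p\ge2$, a $p$-th order Fibonacci string is a binary string that does not contain $1^p$ ($p$ consecutive 1s) as a substring (of consecutive letters). $\Gamma_n^{(p)}$ is the subgraph of $Q_n$ induced by the $p$-th order Fibonacci strings of length $n$; in particular $\Gamma_0^{(p)}=K_1$. $V(G)$ denotes the vertex set of a graph $G$. *)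

theory Defs
  imports
    "Graph_Theory.Digraph_Component"
    "HOL-Library.Sublist"
    "HOL-Computational_Algebra.Formal_Laurent_Series"
begin

text \<open>
  Binary strings are Boolean lists, with True for the letter 1. As usual in the graph library,
  an undirected graph is a symmetric digraph: the edge \<open>{u, v}\<close> is the pair of
  arcs \<open>(u, v)\<close> and \<open>(v, u)\<close>.
\<close>

definition hypercube :: "nat \<Rightarrow> bool list pair_pre_digraph" where
  "hypercube n = \<lparr> pverts = {u. length u = n},
     parcs = {(u, v). length u = n \<and> length v = n \<and> (\<exists>!i. i < n \<and> u ! i \<noteq> v ! i)} \<rparr>"

definition fibonacci_string :: "nat \<Rightarrow> bool list \<Rightarrow> bool" where
  "fibonacci_string p u \<longleftrightarrow> \<not> sublist (replicate p True) u"

definition fibonacci_cube :: "nat \<Rightarrow> nat \<Rightarrow> (bool list, bool list \<times> bool list) pre_digraph" where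
  "fibonacci_cube p n =
     with_proj (hypercube n) \<restriction> {u \<in> pverts (hypercube n). fibonacci_string p u}"

lemma finite_pverts_hypercube: "finite (pverts (hypercube n))"
  using finite_lists_length_eq[of "UNIV :: bool set" n] by (simp add: hypercube_def)

lemma in_parcs_hypercubeD:
  assumes "e \<in> parcs (hypercube n)"
  shows "fst e \<in> pverts (hypercube n)" "snd e \<in> pverts (hypercube n)" "fst e \<noteq> snd e"
proof -
  obtain u v where e: "e = (u, v)" by (rule prod.exhaust)
  from assms have *: "length u = n \<and> length v = n \<and> (\<exists>!i. i < n \<and> u ! i \<noteq> v ! i)"
    unfolding hypercube_def e pair_pre_digraph.simps mem_Collect_eq prod.case .
  then show "fst e \<in> pverts (hypercube n)" "snd e \<in> pverts (hypercube n)"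
    unfolding hypercube_def e pair_pre_digraph.simps mem_Collect_eq fst_conv snd_conv
    by iprover+
  from * show "fst e \<noteq> snd e"
    unfolding e fst_conv snd_conv by blast
qed

lemma pair_graph_hypercube: "pair_graph (hypercube n)"
proof
  show "fst e \<in> pverts (hypercube n)" "snd e \<in> pverts (hypercube n)" "fst e \<noteq> snd e"
    if "e \<in> parcs (hypercube n)" for e
    using in_parcs_hypercubeD[OF that] .
  show "finite (pverts (hypercube n))"
    by (rule finite_pverts_hypercube)
  show "finite (parcs (hypercube n))"
  proof (rule finite_subset)
    show "parcs (hypercube n) \<subseteq> pverts (hypercube n) \<times> pverts (hypercube n)"
      by (intro subsetI) (simp only: mem_Times_iff in_parcs_hypercubeD simp_thms)
    show "finite (pverts (hypercube n) \<times> pverts (hypercube n))"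
      by (intro finite_cartesian_product finite_pverts_hypercube)
  qed
  show "symmetric (with_proj (hypercube n))"
    unfolding symmetric_def with_proj_simps
  proof (rule symI)
    fix u v assume "(u, v) \<in> parcs (hypercube n)"
    then show "(v, u) \<in> parcs (hypercube n)"
      unfolding hypercube_def pair_pre_digraph.simps mem_Collect_eq prod.case by metis
  qed
qed

lemma induced_subgraph_fibonacci_cube:
  "induced_subgraph (fibonacci_cube p n) (with_proj (hypercube n))"
proof -
  have "wf_digraph (with_proj (hypercube n))"
    by (rule wf_digraph.intro; simp add: in_parcs_hypercubeD)
  moreover have "{u \<in> pverts (hypercube n). fibonacci_string p u}
      \<subseteq> verts (with_proj (hypercube n))"
    unfolding with_proj_simps by (rule Collect_restrict)
  ultimately show ?thesis
    unfolding fibonacci_cube_def by (rule wf_digraph.induced_induce)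
qed

end

theory Submission
  imports Defs
begin

text \<open>
  A string without \<open>1\<^sup>p\<close> is determined by its initial run of 1s. Either the run is the whole
  string, which gives one string for each length below \<open>p\<close>, or it has length \<open>i - 1 < p\<close> and is
  closed by a 0, after which any string without \<open>1\<^sup>p\<close> may follow, since the 0 prevents new
  occurrences of \<open>1\<^sup>p\<close> across it (\<open>fibonacci_string_append_False\<close>). Counting both kinds
  (\<open>card_fibonacci_strings_rec\<close>) says that the generating function \<open>F\<close> satisfies
  \<open>F = N + (t + \<dots> + t\<^sup>p) F\<close> with \<open>N = 1 + t + \<dots> + t\<^bsup>p-1\<^esup>\<close>.
  Solving for \<open>F\<close> gives the quotient form.
  The other form is the same quotient, as \<open>t N = t + \<dots> + t\<^sup>p = 1 - D\<close> for the denominator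
  \<open>D\<close>, so that \<open>t F = (1 - D) / D = 1 / D - 1\<close>; Laurent series are a field, in which
  the factor \<open>t\<close> can be moved to the other side.
\<close>

definition fibonacci_strings :: "nat \<Rightarrow> nat \<Rightarrow> bool list set" where
  "fibonacci_strings p n = {u. length u = n \<and> fibonacci_string p u}"

lemma verts_fibonacci_cube: "verts (fibonacci_cube p n) = fibonacci_strings p n"
  by (auto simp: fibonacci_cube_def hypercube_def fibonacci_strings_def induce_subgraph_verts)

lemma finite_fibonacci_strings: "finite (fibonacci_strings p n)"
  by (rule finite_subset[OF _ finite_lists_length_eq[of "UNIV :: bool set" n]])
    (auto simp: fibonacci_strings_def)

lemma prefix_replicate_run:
  "prefix (replicate p True) (replicate j True @ False # w) \<longleftrightarrow> p \<le> j"
proof (induction j arbitrary: p)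
  case 0
  then show ?case by (cases p) auto
next
  case (Suc j)
  then show ?case by (cases p) auto
qed

lemma fibonacci_string_replicate: "fibonacci_string p (replicate n True) \<longleftrightarrow> n < p"
proof
  assume "fibonacci_string p (replicate n True)"
  moreover have "sublist (replicate p True) (replicate n True)" if "p \<le> n"
    using that by (metis le_add_diff_inverse replicate_add sublist_append_rightI)
  ultimately show "n < p"
    by (auto simp: fibonacci_string_def not_le[symmetric])
next
  assume "n < p"
  then show "fibonacci_string p (replicate n True)"
    using sublist_length_le[of "replicate p True" "replicate n True"]
    by (auto simp: fibonacci_string_def)
qed

text \<open>
  A block of 1s cannot contain the displayed 0, so it lies inside the initial run or inside the
  remainder \<open>w\<close>.
\<close>

lemma fibonacci_string_append_False:
  "fibonacci_string p (replicate j True @ False # w) \<longleftrightarrow> j < p \<and> fibonacci_string p w"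
proof (induction j)
  case 0
  show ?case
    using prefix_replicate_run[of p 0 w] by (auto simp: fibonacci_string_def sublist_Cons_right)
next
  case (Suc j)
  then show ?case
    using prefix_replicate_run[of p "Suc j" w]
    by (auto simp: fibonacci_string_def sublist_Cons_right)
qed

lemma initial_run_cases:
  obtains (all) "u = replicate (length u) True"
  | (run) j w where "u = replicate j True @ False # w"
proof (induction u arbitrary: thesis)
  case Nil
  then show ?case by simp
next
  case (Cons b u)
  show ?case
  proof (cases b)
    case False
    then show ?thesis using Cons.prems(2)[of 0 u] by simp
  next
    case True
    show ?thesis
    proof (rule Cons.IH)
      assume "u = replicate (length u) True"
      then show thesis using True Cons.prems(1) by simp
    next
      fix j w assume "u = replicate j True @ False # w"
      then show thesis using True Cons.prems(2)[of "Suc j" w] by simp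
    qed
  qed
qed

lemma initial_run_unique:
  "replicate j True @ False # w = replicate k True @ False # w' \<longleftrightarrow> j = k \<and> w = w'"
proof (induction j arbitrary: k)
  case 0
  then show ?case by (cases k) auto
next
  case (Suc j)
  then show ?case by (cases k) auto
qed

lemma fibonacci_strings_decompose:
  "fibonacci_strings p n = (if n < p then {replicate n True} else {}) \<union>
     (\<Union>i\<in>{i \<in> {1..p}. i \<le> n}.
        (\<lambda>w. replicate (i - 1) True @ False # w) ` fibonacci_strings p (n - i))"
  (is "_ = ?R \<union> (\<Union>i\<in>?I. ?B i)")
proof (intro equalityI subsetI)
  fix u assume u: "u \<in> fibonacci_strings p n"
  show "u \<in> ?R \<union> (\<Union>i\<in>?I. ?B i)"
  proof (cases u rule: initial_run_cases)
    case all
    then have "u = replicate n True" "n < p"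
      using u fibonacci_string_replicate[of p n] by (auto simp: fibonacci_strings_def)
    then show ?thesis by simp
  next
    case (run j w)
    then have "j < p" "fibonacci_string p w" "n = Suc j + length w"
      using u by (auto simp: fibonacci_strings_def fibonacci_string_append_False)
    then have "Suc j \<in> ?I" "u \<in> ?B (Suc j)"
      using run by (auto simp: fibonacci_strings_def)
    then show ?thesis by blast
  qed
next
  fix u assume "u \<in> ?R \<union> (\<Union>i\<in>?I. ?B i)"
  then show "u \<in> fibonacci_strings p n"
    by (auto simp: fibonacci_strings_def fibonacci_string_replicate fibonacci_string_append_False
        split: if_splits)
qed

lemma card_fibonacci_strings_rec:
  "card (fibonacci_strings p n) = (if n < p then 1 else 0) +
     (\<Sum>i=1..p. if n < i then 0 else card (fibonacci_strings p (n - i)))"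
proof -
  define R where "R = (if n < p then {replicate n True} else {})"
  define I where "I = {i \<in> {1..p}. i \<le> n}"
  define B where "B i = (\<lambda>w. replicate (i - 1) True @ False # w) ` fibonacci_strings p (n - i)" for i
  have fin: "finite I" "\<And>i. finite (B i)"
    by (auto simp: I_def B_def finite_fibonacci_strings)
  have card_B: "card (B i) = card (fibonacci_strings p (n - i))" for i
    unfolding B_def by (rule card_image) (auto simp: inj_on_def)
  have disj: "B i \<inter> B k = {}" if "i \<in> I" "k \<in> I" "i \<noteq> k" for i k
    using that by (auto simp: I_def B_def initial_run_unique)
  have "R \<inter> (\<Union>i\<in>I. B i) = {}"
  proof -
    have "False \<in> set u" if "u \<in> B i" for u i
      using that by (auto simp: B_def)
    moreover have "False \<notin> set u" if "u \<in> R" for u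
      using that by (auto simp: R_def split: if_splits)
    ultimately show ?thesis by blast
  qed
  then have "card (fibonacci_strings p n) = card R + card (\<Union>i\<in>I. B i)"
    unfolding fibonacci_strings_decompose[of p n] R_def[symmetric] I_def[symmetric] B_def[symmetric]
    by (intro card_Un_disjoint) (use fin in \<open>auto simp: R_def\<close>)
  also have "card (\<Union>i\<in>I. B i) = (\<Sum>i\<in>I. card (B i))"
    by (rule card_UN_disjoint) (use fin disj in auto)
  also have "\<dots> = (\<Sum>i=1..p. if n < i then 0 else card (fibonacci_strings p (n - i)))"
    unfolding card_B I_def by (subst sum.inter_filter) (auto intro!: sum.cong)
  finally show ?thesis
    by (simp add: R_def)
qed

text \<open>
  Multiplication by \<open>t\<^sup>i\<close> moves the coefficient at \<open>n - i\<close> to \<open>n\<close>, so this is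
  the recurrence read coefficientwise; its first term becomes \<open>1 + t + \<dots> + t\<^bsup>p-1\<^esup>\<close>.
\<close>

lemma fibonacci_strings_fps_equation:
  fixes p :: nat and F :: "'a :: comm_ring_1 fps"
  defines "F \<equiv> Abs_fps (\<lambda>n. of_nat (card (fibonacci_strings p n)))"
  shows "F = (\<Sum>i<p. fps_X ^ i) + (\<Sum>i=1..p. fps_X ^ i) * F"
proof (rule fps_ext)
  fix n
  have "fps_nth (\<Sum>i<p. fps_X ^ i :: 'a fps) n = (if n < p then 1 else 0)"
    by (simp add: fps_sum_nth fps_X_power_nth)
  moreover have "fps_nth ((\<Sum>i=1..p. fps_X ^ i) * F) n =
      (\<Sum>i=1..p. if n < i then 0 else of_nat (card (fibonacci_strings p (n - i))))"
    by (simp add: sum_distrib_right fps_sum_nth fps_X_power_mult_nth F_def cong: if_cong)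
  ultimately show "fps_nth F n =
      fps_nth ((\<Sum>i<p. fps_X ^ i) + (\<Sum>i=1..p. fps_X ^ i) * F) n"
    by (subst F_def, subst fps_nth_Abs_fps, subst card_fibonacci_strings_rec)
      (simp add: of_nat_sum if_distrib[of of_nat] cong: if_cong)
qed

lemma fps_to_fls_sum: "fps_to_fls (\<Sum>i\<in>A. f i) = (\<Sum>i\<in>A. fps_to_fls (f i))"
  by (induction A rule: infinite_finite_induct) auto

theorem corollary4p2:
  fixes p :: nat
  assumes "p \<ge> 2"
  shows "fps_to_fls (Abs_fps (\<lambda>n. of_nat (card (verts (fibonacci_cube p n))) :: rat))
           = inverse fls_X * (1 / (1 - (\<Sum>i=1..p. fls_X ^ i)) - 1)
         \<and> Abs_fps (\<lambda>n. of_nat (card (verts (fibonacci_cube p n))) :: rat)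
           = (\<Sum>i<p. fps_X ^ i) / (1 - (\<Sum>i=1..p. fps_X ^ i))"
proof -
  define F :: "rat fps" where "F = Abs_fps (\<lambda>n. of_nat (card (verts (fibonacci_cube p n))))"
  define N :: "rat fps" where "N = (\<Sum>i<p. fps_X ^ i)"
  define D :: "rat fps" where "D = 1 - (\<Sum>i=1..p. fps_X ^ i)"
  have FD: "F * D = N"
    using fibonacci_strings_fps_equation[of p, where ?'a = rat]
    by (simp add: F_def N_def D_def verts_fibonacci_cube algebra_simps)
  have "fps_nth D 0 = 1"
    by (auto simp: D_def fps_sum_nth fps_X_power_nth)
  then have D0: "D \<noteq> 0" by auto
  have "fps_X * N = (\<Sum>i=1..p. fps_X ^ i)"
    unfolding N_def sum_distrib_left power_Suc[symmetric]
    by (rule sum.reindex_bij_witness[of _ "\<lambda>i. i - 1" Suc]) auto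
  then have XN: "fps_X * N = 1 - D"
    by (simp add: D_def)
  have "F = N / D"
    using FD D0 by (metis nonzero_mult_div_cancel_right)
  moreover have "fps_to_fls F = inverse fls_X * (1 / fps_to_fls D - 1)"
  proof -
    have "fps_to_fls F * fps_to_fls D = fps_to_fls N"
      using FD by (metis fls_times_fps_to_fls)
    moreover have "fls_X * fps_to_fls N = 1 - fps_to_fls D"
      using arg_cong[OF XN, of fps_to_fls] by (simp add: fls_times_fps_to_fls)
    ultimately have "fls_X * fps_to_fls F * fps_to_fls D = 1 - fps_to_fls D"
      by (simp add: mult.assoc)
    moreover have "fps_to_fls D \<noteq> 0" "(fls_X :: rat fls) \<noteq> 0"
      using D0 by auto
    (* stated for a variable x because inverse fls_X simplifies to a shift of 1 *)
    moreover have "f = inverse x * (1 / d - 1)"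
      if "x * f * d = 1 - d" "d \<noteq> 0" "x \<noteq> 0" for x f d :: "rat fls"
      using that by (simp add: field_simps)
    ultimately show ?thesis by blast
  qed
  moreover have "fps_to_fls D = 1 - (\<Sum>i=1..p. fls_X ^ i)"
    by (simp add: D_def fps_to_fls_sum fps_to_fls_power)
  ultimately show ?thesis
    by (simp add: F_def N_def D_def)
qed

end
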